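(* For $\rho\in\mathbb{R}$ let $$\hat\alpha_0(\rho)=F(\rho)\left(1-\frac{\rho\,F(-\rho)}{f(\rho)}\right).$$ Then $$\frac{d\hat\alpha_0(\rho)}{d\rho}\Big|_{\rho=0}=\frac12\left(\sqrt{\frac{2}{\pi}}-\sqrt{\frac{\pi}{2}}\right)\approx-0.2277.$$
   Context: $F(\cdot)$ and $f(\cdot)$ denote the standard normal distribution function and the standard normal density $f(t)=\frac{1}{\sqrt{2\pi}}e^{-t^2/2}$. The function $\hat\alpha_0(\rho)$ is the estimate of the optimal majority (acceptance) threshold as a function of the normalized mean $\rho=\mu/\sigma$ of the environment. The symbol $\approx$ indicates the numerical value rounded to four decimal places. *)

theory Defs
  imports "HOL-Probability.Probability"
begin

abbreviation std_normal_cdf :: "real \<Rightarrow> real" where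
  "std_normal_cdf \<equiv> cdf std_normal_distribution"

definition alpha0_hat :: "real \<Rightarrow> real" where
  "alpha0_hat \<rho> =
     std_normal_cdf \<rho> * (1 - \<rho> * std_normal_cdf (- \<rho>) / std_normal_density \<rho>)"

definition rounds_to :: "nat \<Rightarrow> real \<Rightarrow> real \<Rightarrow> bool" where
  "rounds_to d x y \<longleftrightarrow> y = real_of_int (round (10 ^ d * x)) / 10 ^ d"

end

theory Submission
  imports Defs
begin

text \<open>
  Write \<open>F\<close> and \<open>f\<close> for the distribution function and the density of the standard normal law.
  In \<open>F(\<rho>) * (1 - \<rho> * F(-\<rho>) / f(\<rho>))\<close> the subtracted term vanishes to first order at \<open>0\<close>
  with slope \<open>F(0) / f(0)\<close>, so the product rule gives the derivative
  \<open>f(0) - F(0)\<^sup>2 / f(0)\<close>.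
  Two facts evaluate it: \<open>F' = f\<close>, because \<open>f\<close> is continuous
  (lemma \<open>has_real_derivative_cdf_density\<close>), and \<open>F(0) = 1/2\<close>, because \<open>f\<close> is even
  (lemma \<open>cdf_density_even_zero\<close>).
  With \<open>f(0) = 1 / sqrt(2 * pi)\<close> the two terms become
  \<open>sqrt(2 / pi) / 2\<close> and \<open>sqrt(pi / 2) / 2\<close>.

  For the decimal value, put \<open>s = sqrt(pi / 2)\<close>. The derivative is then
  \<open>(1 / s - s) / 2\<close>, which is decreasing in \<open>s\<close>, so that rational bounds on \<open>s\<close> suffice.
\<close>

text \<open>
  The increment of the distribution function over an interval is the integral of the density,
  and the fundamental theorem of calculus differentiates that integral.
\<close>

lemma has_real_derivative_cdf_density:
  fixes f :: "real \<Rightarrow> real"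
  assumes dist: "real_distribution (density lborel f)"
    and cont: "continuous_on UNIV f"
    and nonneg: "\<And>x. 0 \<le> f x"
  shows "(cdf (density lborel f) has_real_derivative f x) (at x)"
proof -
  let ?M = "density lborel f"
  interpret real_distribution ?M by (rule dist)
  have f_meas [measurable]: "f \<in> borel_measurable borel"
    using cont by (rule borel_measurable_continuous_onI)
  \<comment> \<open>The base point is shifted to the left of \<open>x\<close> to make \<open>x\<close> interior.\<close>
  let ?a = "x - 1" and ?b = "x + 1"
  have cdf_eq: "cdf ?M u = cdf ?M ?a + (LBINT y=?a..u. f y)" if "?a < u" for u
  proof -
    have "cdf ?M u - cdf ?M ?a = measure ?M {?a<..u}"
      using that by (rule cdf_diff_eq)
    also have "\<dots> = (\<integral>y. indicator {?a<..u} y \<partial>?M)"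
      by simp
    also have "\<dots> = (LINT y|lborel. f y *\<^sub>R indicator {?a<..u} y)"
      by (rule integral_density) (auto simp: nonneg)
    also have "\<dots> = (LBINT y=?a..u. f y)"
      using that by (simp add: interval_integral_Ioc set_lebesgue_integral_def mult.commute)
    finally show ?thesis by simp
  qed
  have "((\<lambda>u. LBINT y=?a..u. f y) has_vector_derivative f x) (at x within {?a..?b})"
    by (rule interval_integral_FTC2) (auto intro: continuous_on_subset[OF cont])
  then have "((\<lambda>u. LBINT y=?a..u. f y) has_real_derivative f x) (at x)"
    by (simp add: has_real_derivative_iff_has_vector_derivative at_within_Icc_at)
  then have "((\<lambda>u. cdf ?M ?a + (LBINT y=?a..u. f y)) has_real_derivative f x) (at x)"
    using DERIV_add[OF DERIV_const[of "cdf ?M ?a"]] by fastforce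
  then show ?thesis
    by (rule has_field_derivative_transform_within_open[where S = "{?a<..<?b}"])
       (auto simp: cdf_eq)
qed

text \<open>
  For an even density, \<open>F(x) + F(-x)\<close> has derivative \<open>f(x) - f(-x) = 0\<close>, so it is
  constant. Its limit at infinity is \<open>1 + 0\<close>, and its value at \<open>0\<close> is \<open>2 * F(0)\<close>.
\<close>

lemma cdf_density_even_zero:
  fixes f :: "real \<Rightarrow> real"
  assumes dist: "real_distribution (density lborel f)"
    and cont: "continuous_on UNIV f"
    and nonneg: "\<And>x. 0 \<le> f x"
    and even: "\<And>x. f (- x) = f x"
  shows "cdf (density lborel f) 0 = 1 / 2"
proof -
  let ?F = "cdf (density lborel f)"
  interpret real_distribution "density lborel f" by (rule dist)
  note deriv = has_real_derivative_cdf_density[OF dist cont nonneg]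
  have "((\<lambda>x. ?F x + ?F (- x)) has_real_derivative 0) (at x)" for x
    by (auto intro!: derivative_eq_intros DERIV_chain2[OF deriv] deriv simp: even)
  then have const: "?F x + ?F (- x) = ?F 0 + ?F (- 0)" for x
    by (rule DERIV_isconst_all[of "\<lambda>x. ?F x + ?F (- x)", rule_format])
  have "((\<lambda>x. ?F x + ?F (- x)) \<longlongrightarrow> 1 + 0) at_top"
    by (intro tendsto_add cdf_lim_at_top_prob
          filterlim_compose[OF cdf_lim_at_bot filterlim_uminus_at_bot_at_top])
  moreover have "((\<lambda>x. ?F x + ?F (- x)) \<longlongrightarrow> ?F 0 + ?F (- 0)) at_top"
    by (intro tendsto_eventually always_eventually allI const)
  ultimately have "?F 0 + ?F (- 0) = 1 + 0"
    by (intro tendsto_unique[of at_top]) auto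
  then show ?thesis by simp
qed

lemma continuous_on_std_normal_density: "continuous_on UNIV std_normal_density"
  unfolding normal_density_def by (intro continuous_intros) auto

lemma has_real_derivative_std_normal_cdf:
  "(std_normal_cdf has_real_derivative std_normal_density x) (at x)"
  by (rule has_real_derivative_cdf_density
        [OF real_dist_normal_dist continuous_on_std_normal_density]) simp

lemma std_normal_cdf_zero: "std_normal_cdf 0 = 1 / 2"
  by (rule cdf_density_even_zero[OF real_dist_normal_dist continuous_on_std_normal_density])
     (simp_all add: normal_density_def)

lemma has_real_derivative_std_normal_density:
  "(std_normal_density has_real_derivative - x * std_normal_density x) (at x)"
  unfolding normal_density_def
  by (rule DERIV_cong, rule DERIV_cmult, (rule derivative_eq_intros refl | simp)+)

lemma has_real_derivative_alpha0_hat_zero: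
  "(alpha0_hat has_real_derivative
     std_normal_density 0 - (1 / 2)\<^sup>2 / std_normal_density 0) (at 0)"
proof -
  have pos: "std_normal_density 0 \<noteq> 0"
    by (simp add: normal_density_def)
  have reflected: "((\<lambda>\<rho>. std_normal_cdf (- \<rho>)) has_real_derivative
      std_normal_density (- 0) * (- 1)) (at 0)"
    by (rule DERIV_chain2[OF has_real_derivative_std_normal_cdf])
       (auto intro!: derivative_eq_intros)
  have "((\<lambda>\<rho>. std_normal_cdf \<rho> *
            (1 - \<rho> * std_normal_cdf (- \<rho>) / std_normal_density \<rho>))
          has_real_derivative
          std_normal_density 0 - (1 / 2)\<^sup>2 / std_normal_density 0) (at 0)"
    by (rule DERIV_cong[OF DERIV_mult[OF has_real_derivative_std_normal_cdf
              DERIV_diff[OF DERIV_const DERIV_divide[OF DERIV_mult[OF DERIV_ident reflected]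
                has_real_derivative_std_normal_density pos]]]])
       (use pos in \<open>simp add: std_normal_cdf_zero power2_eq_square\<close>)
  then show ?thesis
    unfolding alpha0_hat_def[abs_def] .
qed

text \<open>
  Bounds for the decimal value: they place \<open>(1 / s - s) / 2\<close> for \<open>s = sqrt(pi / 2)\<close>
  between \<open>-0.22772\<close> and \<open>-0.22771\<close>.
\<close>

lemma sqrt_half_pi_bounds: "1.25331 < sqrt (pi / 2)" "sqrt (pi / 2) < 1.25332"
proof -
  show "1.25331 < sqrt (pi / 2)"
    by (rule real_less_rsqrt) (use pi_approx in \<open>simp add: power2_eq_square\<close>)
  show "sqrt (pi / 2) < 1.25332"
    by (rule real_less_lsqrt) (use pi_approx in \<open>simp_all add: power2_eq_square\<close>)
qed

theorem corollary1:
  shows "(alpha0_hat has_real_derivative (1 / 2) * (sqrt (2 / pi) - sqrt (pi / 2))) (at 0) \<and>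
         rounds_to 4 ((1 / 2) * (sqrt (2 / pi) - sqrt (pi / 2))) (- 0.2277)"
proof
  let ?s = "sqrt (pi / 2)"
  have inv: "sqrt (2 / pi) = 1 / ?s"
    by (simp add: real_sqrt_divide)
  have "sqrt (2 * pi) = 2 * ?s"
    using real_sqrt_mult[of 4 "pi / 2"] by simp
  then have density: "std_normal_density 0 = 1 / (2 * ?s)"
    by (simp add: normal_density_def)
  have "std_normal_density 0 - (1 / 2)\<^sup>2 / std_normal_density 0
      = (1 / 2) * (sqrt (2 / pi) - ?s)"
    unfolding inv density by (simp add: power2_eq_square right_diff_distrib)
  then show "(alpha0_hat has_real_derivative (1 / 2) * (sqrt (2 / pi) - ?s)) (at 0)"
    by (rule DERIV_cong[OF has_real_derivative_alpha0_hat_zero])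

  have "0.79788 < sqrt (2 / pi)" "sqrt (2 / pi) < 0.79789"
    unfolding inv using sqrt_half_pi_bounds by (simp_all add: pos_less_divide_eq pos_divide_less_eq)
  then have "round (10 ^ 4 * ((1 / 2) * (sqrt (2 / pi) - ?s))) = - 2277"
    using sqrt_half_pi_bounds by (intro round_unique', unfold abs_less_iff) (auto simp: field_simps)
  then show "rounds_to 4 ((1 / 2) * (sqrt (2 / pi) - ?s)) (- 0.2277)"
    unfolding rounds_to_def by simp
qed

end
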